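(* Let $(N,v,H)$ be any hypergraph communication situation, let $k\ge 1$ be any positive integer, let $(U(H)^k,w^k)$ be the $k$-augmented uniform hyperlink game of $(N,v,H)$, and let $\pi$ be the position value. Then for every $i\in N$, $$\pi_i(N,v,H)=\sum_{l\in U(H)^k(i)}Sh_l(U(H)^k,w^k).$$
   Context: A TU-game is a pair $(N,v)$ with $N$ a finite player set and $v:2^N\to\mathbf{R}$ with $v(\emptyset)=0$; it is zero-normalized if $v(\{i\})=0$ for all $i\in N$. The Shapley value of $(N,v)$ is $Sh_i(N,v)=\frac{1}{|\Sigma(N)|}\sum_{\sigma\in\Sigma(N)}\big(v(\sigma^i\cup\{i\})-v(\sigma^i)\big)$, where $\Sigma(N)$ is the set of permutations of $N$ and $\sigma^i=\{j\in N\mid\sigma(j)<\sigma(i)\}$. A hypergraph communication situation (hypergraph game) is a triple $(N,v,H)$ where $N=\{1,\dots,n\}$, $n\ge 2$, $(N,v)$ is a zero-normalized TU-game, and $H\subseteq\{e\subseteq N\mid |e|>1\}$ is a set of hyperlinks. For $i\in N$, $H_i=\{e\in H\mid i\in e\}$. For $H'\subseteq H$, two nodes are adjacent in $(N,H')$ if some hyperlink of $H'$ contains both; two nodes are connected if they are joined by a finite sequence of nodes with consecutive ones adjacent (each node is connected to itself); $N/H'$ is the set of components (maximal sets of pairwise connected nodes) of $(N,H')$. The hyperlink game $(H,v^N)$ has player set $H$ and $v^N(H')=\sum_{T\in N/H'}v(T)$ for $H'\subseteq H$. The position value is $\pi_i(N,v,H)=\sum_{e\in H_i}\frac{1}{|e|}Sh_e(H,v^N)$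 for $i\in N$. $k$-augmented uniform hyperlink game $(U(H)^k,w^k)$: let $\eta(H)$ be the least common multiple of the numbers in $\{|e|\mid e\in H\}$ (equal to $1$ if $H=\emptyset$) and $\rho(k)=k\cdot\eta(H)$. For $e\in H$ and $i\in e$ put $U(H)^k(i,e)=\{(i,e,t)\mid t=1,\dots,\rho(k)/|e|\}$; $U(H)^k(i)=\bigcup_{e\in H_i}U(H)^k(i,e)$; $U(H)^k(e)=\bigcup_{i\in e}U(H)^k(i,e)$; $U(H)^k=\bigcup_{i\in N}U(H)^k(i)=\bigcup_{e\in H}U(H)^k(e)$. For $S\subseteq U(H)^k$, $w^k(S)=\sum_{R\in N/H[S]}v(R)$, where $H[S]=\{e\in H\mid U(H)^k(e)\subseteq S\}$. *)

theory Defs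
  imports Complex_Main "HOL-Library.FuncSet"
begin

section \<open>TU-games and the Shapley value\<close>

text \<open>
  A characteristic function is a total function on sets of players; for a game on \<open>N\<close> only its
  values on subsets of \<open>N\<close> are ever used.
\<close>

definition tu_game :: "'p set \<Rightarrow> ('p set \<Rightarrow> real) \<Rightarrow> bool" where
  "tu_game N v \<longleftrightarrow> finite N \<and> v {} = 0"

definition zero_normalized :: "'p set \<Rightarrow> ('p set \<Rightarrow> real) \<Rightarrow> bool" where
  "zero_normalized N v \<longleftrightarrow> (\<forall>i\<in>N. v {i} = 0)"

text \<open>
  Player sets are arbitrary finite sets (hyperlinks, triples) that carry no order of their own, so a
  permutation \<open>\<sigma>\<close> of \<open>N\<close> assigns to each player its position \<open>\<sigma> i\<close> in \<open>{1..card N}\<close>. Extensionality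
  makes each permutation count exactly once.
\<close>

definition permutations_of_players :: "'p set \<Rightarrow> ('p \<Rightarrow> nat) set" where
  "permutations_of_players N = {\<sigma> \<in> extensional N. bij_betw \<sigma> N {1..card N}}"

definition predecessors :: "'p set \<Rightarrow> ('p \<Rightarrow> nat) \<Rightarrow> 'p \<Rightarrow> 'p set" where
  "predecessors N \<sigma> i = {j \<in> N. \<sigma> j < \<sigma> i}"

definition shapley :: "'p set \<Rightarrow> ('p set \<Rightarrow> real) \<Rightarrow> 'p \<Rightarrow> real" where
  "shapley N v i =
     1 / real (card (permutations_of_players N)) *
     (\<Sum>\<sigma>\<in>permutations_of_players N.
        v (predecessors N \<sigma> i \<union> {i}) - v (predecessors N \<sigma> i))"

section \<open>Hypergraph communication situations\<close>

definition hypergraph_situation ::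
  "nat set \<Rightarrow> (nat set \<Rightarrow> real) \<Rightarrow> nat set set \<Rightarrow> bool" where
  "hypergraph_situation N v H \<longleftrightarrow>
     (\<exists>n\<ge>2. N = {1..n}) \<and> tu_game N v \<and> zero_normalized N v \<and>
     H \<subseteq> {e. e \<subseteq> N \<and> card e > 1}"

definition links_at :: "nat set set \<Rightarrow> nat \<Rightarrow> nat set set" where
  "links_at H i = {e \<in> H. i \<in> e}"

definition adjacent_nodes :: "nat set \<Rightarrow> nat set set \<Rightarrow> nat \<Rightarrow> nat \<Rightarrow> bool" where
  "adjacent_nodes N H i j \<longleftrightarrow> i \<in> N \<and> j \<in> N \<and> (\<exists>e\<in>H. i \<in> e \<and> j \<in> e)"

definition connected_nodes :: "nat set \<Rightarrow> nat set set \<Rightarrow> nat \<Rightarrow> nat \<Rightarrow> bool" where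
  "connected_nodes N H i j \<longleftrightarrow> i \<in> N \<and> j \<in> N \<and> (adjacent_nodes N H)\<^sup>*\<^sup>* i j"

definition pairwise_connected :: "nat set \<Rightarrow> nat set set \<Rightarrow> nat set \<Rightarrow> bool" where
  "pairwise_connected N H T \<longleftrightarrow> T \<subseteq> N \<and> (\<forall>i\<in>T. \<forall>j\<in>T. connected_nodes N H i j)"

definition components_of :: "nat set \<Rightarrow> nat set set \<Rightarrow> nat set set" where
  "components_of N H =
     {T. pairwise_connected N H T \<and>
         (\<forall>T'. pairwise_connected N H T' \<and> T \<subseteq> T' \<longrightarrow> T' = T)}"

section \<open>Hyperlink game and position value\<close>

definition hyperlink_game :: "nat set \<Rightarrow> (nat set \<Rightarrow> real) \<Rightarrow> nat set set \<Rightarrow> real" where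
  "hyperlink_game N v H' = (\<Sum>T\<in>components_of N H'. v T)"

definition position_value ::
  "nat set \<Rightarrow> (nat set \<Rightarrow> real) \<Rightarrow> nat set set \<Rightarrow> nat \<Rightarrow> real" where
  "position_value N v H i =
     (\<Sum>e\<in>links_at H i. 1 / real (card e) * shapley H (hyperlink_game N v) e)"

section \<open>The augmented uniform hyperlink game\<close>

text \<open>The library's \<open>Lcm\<close> of the empty set is \<open>1\<close>.\<close>

definition \<eta> :: "nat set set \<Rightarrow> nat" where
  "\<eta> H = Lcm (card ` H)"

definition \<rho> :: "nat set set \<Rightarrow> nat \<Rightarrow> nat" where
  "\<rho> H k = k * \<eta> H"

text \<open>A player \<open>(i, e, t)\<close> is the \<open>t\<close>-th copy assigned to node \<open>i\<close> in hyperlink \<open>e\<close>.\<close>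

type_synonym aug_player = "nat \<times> nat set \<times> nat"

text \<open>For \<open>e \<in> H\<close> the division is exact, see \<open>card_dvd_\<rho>\<close> below.\<close>

definition U_node_link :: "nat set set \<Rightarrow> nat \<Rightarrow> nat \<Rightarrow> nat set \<Rightarrow> aug_player set" where
  "U_node_link H k i e = {(i, e, t) | t. t \<in> {1..\<rho> H k div card e}}"

definition U_node :: "nat set set \<Rightarrow> nat \<Rightarrow> nat \<Rightarrow> aug_player set" where
  "U_node H k i = (\<Union>e\<in>links_at H i. U_node_link H k i e)"

definition U_link :: "nat set set \<Rightarrow> nat \<Rightarrow> nat set \<Rightarrow> aug_player set" where
  "U_link H k e = (\<Union>i\<in>e. U_node_link H k i e)"

definition U_all :: "nat set \<Rightarrow> nat set set \<Rightarrow> nat \<Rightarrow> aug_player set" where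
  "U_all N H k = (\<Union>i\<in>N. U_node H k i)"

definition complete_links :: "nat set set \<Rightarrow> nat \<Rightarrow> aug_player set \<Rightarrow> nat set set" where
  "complete_links H k S = {e \<in> H. U_link H k e \<subseteq> S}"

definition augmented_game ::
  "nat set \<Rightarrow> (nat set \<Rightarrow> real) \<Rightarrow> nat set set \<Rightarrow> nat \<Rightarrow> aug_player set \<Rightarrow> real" where
  "augmented_game N v H k S = (\<Sum>R\<in>components_of N (complete_links H k S). v R)"

lemma card_dvd_\<rho>: "e \<in> H \<Longrightarrow> card e dvd \<rho> H k"
  by (simp add: \<rho>_def \<eta>_def)

lemma U_all_eq_UN_U_link:
  assumes "hypergraph_situation N v H"
  shows "U_all N H k = (\<Union>e\<in>H. U_link H k e)"
  using assms
  by (fastforce simp: hypergraph_situation_def U_all_def U_node_def U_link_def links_at_def)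

end

theory Submission
  imports Defs "HOL-Library.Disjoint_Sets" "HOL-Combinatorics.Transposition"
begin

text \<open>
  By linearity of the Shapley value it is enough to treat unanimity games: the value of the
  unanimity game of \<open>T\<close> is \<open>1 / card T\<close> on \<open>T\<close> and \<open>0\<close> elsewhere. Replacing every hyperlink by
  \<open>m = \<rho> H k\<close> copies that are only effective together turns the unanimity game of a set of
  \<open>t\<close> links into the unanimity game of a set of \<open>m t\<close> copies, so that each copy receives exactly
  \<open>1 / m\<close> of the value of its hyperlink. A node owns \<open>m / card e\<close> copies of each of its links \<open>e\<close>.
\<close>

section \<open>The Shapley value\<close>

lemma finite_permutations_of_players:
  assumes "finite N"
  shows "finite (permutations_of_players N)"
proof (rule finite_subset)
  show "permutations_of_players N \<subseteq> (\<Pi>\<^sub>E i\<in>N. {1..card N})"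
    by (auto simp: permutations_of_players_def PiE_def bij_betw_def)
  show "finite (\<Pi>\<^sub>E i\<in>N. {1..card N})"
    using assms by (intro finite_PiE) auto
qed

lemma card_permutations_of_players_pos:
  assumes "finite N"
  shows "card (permutations_of_players N) > 0"
proof -
  obtain h where "bij_betw h N {1..card N}"
    using finite_same_card_bij[OF assms, of "{1..card N}"] by auto
  then have "restrict h N \<in> permutations_of_players N"
    by (simp add: permutations_of_players_def bij_betw_cong[of N "restrict h N" h])
  then show ?thesis
    using finite_permutations_of_players[OF assms] by (auto simp: card_gt_0_iff)
qed

text \<open>Orders only ever produce coalitions inside \<open>N\<close>. This lets a game be
  exchanged for its dividend expansion, which is guaranteed only on subsets of
  \<open>N\<close>.\<close>

lemma shapley_cong:
  assumes "l \<in> N" and "\<And>S. S \<subseteq> N \<Longrightarrow> v S = w S"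
  shows "shapley N v l = shapley N w l"
proof -
  have "predecessors N \<sigma> l \<subseteq> N" for \<sigma>
    by (auto simp: predecessors_def)
  then show ?thesis
    using assms by (simp add: shapley_def)
qed

lemma shapley_sum:
  "shapley N (\<lambda>S. \<Sum>T\<in>A. c T * v T S) l = (\<Sum>T\<in>A. c T * shapley N (v T) l)"
proof -
  have "shapley N (\<lambda>S. \<Sum>T\<in>A. c T * v T S) l =
      1 / real (card (permutations_of_players N)) *
      (\<Sum>\<sigma>\<in>permutations_of_players N. \<Sum>T\<in>A.
        c T * (v T (predecessors N \<sigma> l \<union> {l}) - v T (predecessors N \<sigma> l)))"
    by (simp add: shapley_def sum_subtractf right_diff_distrib)
  also have "\<dots> = (\<Sum>T\<in>A. c T * shapley N (v T) l)"
    by (subst sum.swap) (simp add: shapley_def sum_distrib_left mult_ac)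
  finally show ?thesis .
qed

section \<open>Unanimity games: dividends and Shapley value\<close>

definition unanimity_game :: "'p set \<Rightarrow> 'p set \<Rightarrow> real" where
  "unanimity_game T S = of_bool (T \<subseteq> S)"

text \<open>Moebius inversion on the subset lattice; the coefficients are the Harsanyi dividends.
  The index \<open>T = {}\<close> belongs to the constant game 1, which carries the value
  \<open>v {}\<close> and gives every player Shapley value 0.\<close>

lemma ex_dividends:
  assumes "finite N"
  shows "\<exists>c. \<forall>S\<subseteq>N. v S = (\<Sum>T\<in>Pow N. c T * unanimity_game T S)"
proof -
  define f :: "'a set \<Rightarrow> real" where "f S = (\<Sum>T\<in>Pow S. (-1) ^ card T * v T)" for S
  have "v S = (\<Sum>T\<in>Pow N. ((-1) ^ card T * f T) * unanimity_game T S)" if "S \<subseteq> N" for S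
  proof -
    \<comment> \<open>The signed subset sum that defines \<open>f\<close> from \<open>v\<close> is
      its own inverse.\<close>
    have "v S = (\<Sum>T\<in>Pow S. (-1) ^ card T * f T)"
      using inclusion_exclusion_symmetric[of f v S] finite_subset[OF that assms]
      by (simp add: f_def)
    also have "\<dots> = (\<Sum>T\<in>Pow S. ((-1) ^ card T * f T) * unanimity_game T S)"
      by (intro sum.cong) (auto simp: unanimity_game_def)
    \<comment> \<open>The added terms vanish, and the index set no longer depends on
      \<open>S\<close>, as linearity requires.\<close>
    also have "\<dots> = (\<Sum>T\<in>Pow N. ((-1) ^ card T * f T) * unanimity_game T S)"
      using assms that by (intro sum.mono_neutral_left) (auto simp: unanimity_game_def)
    finally show ?thesis .
  qed
  then show ?thesis
    by (intro exI[of _ "\<lambda>T. (-1) ^ card T * f T"]) blast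
qed

text \<open>For \<open>l\<close> in \<open>T\<close> these are the orders in which \<open>l\<close>
  is pivotal in the unanimity game of \<open>T\<close>: its arrival completes
  \<open>T\<close>.\<close>

definition orders_ending_in :: "'p set \<Rightarrow> 'p set \<Rightarrow> 'p \<Rightarrow> ('p \<Rightarrow> nat) set" where
  "orders_ending_in N T l = {\<sigma> \<in> permutations_of_players N. \<forall>j\<in>T. \<sigma> j \<le> \<sigma> l}"

text \<open>Swapping the positions of \<open>a\<close> and \<open>b\<close> hands the last place to
  \<open>b\<close>; since both lie in \<open>T\<close>, the set of positions taken by
  \<open>T\<close> is unchanged.\<close>

lemma comp_transpose_in_orders_ending_in:
  assumes "a \<in> T" "b \<in> T" "T \<subseteq> N" and \<sigma>: "\<sigma> \<in> orders_ending_in N T a"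
  shows "\<sigma> \<circ> transpose a b \<in> orders_ending_in N T b"
proof -
  have "bij_betw (transpose a b) N N"
    using assms by (intro bij_betw_byWitness[where f' = "transpose a b"])
      (auto simp: transpose_def)
  then have "bij_betw (\<sigma> \<circ> transpose a b) N {1..card N}"
    using \<sigma> by (auto simp: orders_ending_in_def permutations_of_players_def intro: bij_betw_trans)
  moreover have "\<sigma> \<circ> transpose a b \<in> extensional N"
    using assms by (auto simp: orders_ending_in_def permutations_of_players_def extensional_def
        transpose_def)
  moreover have "(\<sigma> \<circ> transpose a b) j \<le> (\<sigma> \<circ> transpose a b) b" if "j \<in> T" for j
    using assms that by (auto simp: orders_ending_in_def transpose_def)
  ultimately show ?thesis
    by (auto simp: orders_ending_in_def permutations_of_players_def)
qed

lemma card_orders_ending_in_eq: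
  assumes "a \<in> T" "b \<in> T" "T \<subseteq> N"
  shows "card (orders_ending_in N T a) = card (orders_ending_in N T b)"
proof (rule bij_betw_same_card)
  show "bij_betw (\<lambda>\<sigma>. \<sigma> \<circ> transpose a b) (orders_ending_in N T a) (orders_ending_in N T b)"
  \<comment> \<open>The swap is an involution, hence its own inverse.\<close>
  proof (rule bij_betw_byWitness[where f' = "\<lambda>\<sigma>. \<sigma> \<circ> transpose a b"])
    show "(\<lambda>\<sigma>. \<sigma> \<circ> transpose a b) ` orders_ending_in N T a \<subseteq> orders_ending_in N T b"
      using comp_transpose_in_orders_ending_in[OF assms] by blast
    show "(\<lambda>\<sigma>. \<sigma> \<circ> transpose a b) ` orders_ending_in N T b \<subseteq> orders_ending_in N T a"
      using comp_transpose_in_orders_ending_in[OF assms(2,1,3)]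
      by (auto simp: transpose_commute)
  qed (auto simp: comp_assoc)
qed

text \<open>Classify the orders by the member of \<open>T\<close> that comes last: this gives
  \<open>card T\<close> disjoint classes, equally large by symmetry.\<close>

lemma card_orders_ending_in:
  assumes "finite N" "T \<subseteq> N" "l \<in> T"
  shows "card T * card (orders_ending_in N T l) = card (permutations_of_players N)"
proof -
  have "finite T"
    using assms finite_subset by blast
  have "permutations_of_players N = (\<Union>a\<in>T. orders_ending_in N T a)"
  proof (intro equalityI subsetI)
    fix \<sigma> assume \<sigma>: "\<sigma> \<in> permutations_of_players N"
    have "Max (\<sigma> ` T) \<in> \<sigma> ` T"
      using \<open>finite T\<close> assms by (intro Max_in) auto
    then obtain a where a: "a \<in> T" "\<sigma> a = Max (\<sigma> ` T)"
      by force
    then have "\<forall>j\<in>T. \<sigma> j \<le> \<sigma> a"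
      using \<open>finite T\<close> by simp
    then show "\<sigma> \<in> (\<Union>a\<in>T. orders_ending_in N T a)"
      using a(1) \<sigma> by (auto simp only: orders_ending_in_def)
  qed (auto simp: orders_ending_in_def)
  moreover have "orders_ending_in N T a \<inter> orders_ending_in N T b = {}"
    if "a \<in> T" "b \<in> T" "a \<noteq> b" for a b
  proof -
    \<comment> \<open>Without ties, two members of \<open>T\<close> cannot both come last.\<close>
    have "\<sigma> a \<noteq> \<sigma> b" if "\<sigma> \<in> permutations_of_players N" for \<sigma>
      using that \<open>a \<in> T\<close> \<open>b \<in> T\<close> \<open>a \<noteq> b\<close> assms(2)
      by (auto simp: permutations_of_players_def bij_betw_def inj_on_def)
    then show ?thesis
      using that by (force simp: orders_ending_in_def)
  qed
  moreover have "finite (orders_ending_in N T a)" for a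
    using finite_permutations_of_players[OF assms(1)] by (simp add: orders_ending_in_def)
  ultimately have "card (permutations_of_players N) = (\<Sum>a\<in>T. card (orders_ending_in N T a))"
    using \<open>finite T\<close> by (simp add: card_UN_disjoint)
  also have "\<dots> = (\<Sum>a\<in>T. card (orders_ending_in N T l))"
    using assms by (intro sum.cong card_orders_ending_in_eq) auto
  finally show ?thesis
    by simp
qed

lemma shapley_unanimity_game:
  assumes "finite N" "T \<subseteq> N"
  shows "shapley N (unanimity_game T) l = (if l \<in> T then 1 / real (card T) else 0)"
proof (cases "l \<in> T")
  case False
  \<comment> \<open>A player outside \<open>T\<close> never completes \<open>T\<close>, so all its
    marginal contributions are 0.\<close>
  then have "T \<subseteq> P \<union> {l} \<longleftrightarrow> T \<subseteq> P" for P
    by auto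
  then show ?thesis
    using False by (simp add: shapley_def unanimity_game_def)
next
  case True
  let ?\<Sigma> = "permutations_of_players N"
  have "unanimity_game T (predecessors N \<sigma> l \<union> {l}) - unanimity_game T (predecessors N \<sigma> l) =
      of_bool (\<sigma> \<in> orders_ending_in N T l)" if \<sigma>: "\<sigma> \<in> ?\<Sigma>" for \<sigma>
  proof -
    have "inj_on \<sigma> N"
      using \<sigma> by (auto simp: permutations_of_players_def bij_betw_def)
    then have "\<sigma> j \<le> \<sigma> l \<longleftrightarrow> j = l \<or> \<sigma> j < \<sigma> l" if "j \<in> T" for j
      using that True assms(2) by (auto simp: order_le_less inj_on_def)
    then have "T \<subseteq> predecessors N \<sigma> l \<union> {l} \<longleftrightarrow> \<sigma> \<in> orders_ending_in N T l"
      using assms(2) \<sigma> by (auto simp: predecessors_def orders_ending_in_def)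
    moreover have "\<not> T \<subseteq> predecessors N \<sigma> l"
      using True by (auto simp: predecessors_def)
    ultimately show ?thesis
      by (simp add: unanimity_game_def)
  qed
  then have "shapley N (unanimity_game T) l =
      1 / real (card ?\<Sigma>) * (\<Sum>\<sigma>\<in>?\<Sigma>. of_bool (\<sigma> \<in> orders_ending_in N T l))"
    by (simp add: shapley_def)
  also have "(\<Sum>\<sigma>\<in>?\<Sigma>. of_bool (\<sigma> \<in> orders_ending_in N T l)) =
      real (card (orders_ending_in N T l))"
    using finite_permutations_of_players[OF assms(1)]
    by (simp add: sum.If_cases of_bool_def orders_ending_in_def Int_def)
  \<comment> \<open>Once the total is written as a product, its positivity makes both factors
    nonzero, so the common count cancels.\<close>
  also have "1 / real (card ?\<Sigma>) * real (card (orders_ending_in N T l)) = 1 / real (card T)"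
    using card_permutations_of_players_pos[OF assms(1)]
    unfolding card_orders_ending_in[OF assms True, symmetric] by simp
  finally show ?thesis
    using True by simp
qed

section \<open>Replacing players by equally large blocks of copies\<close>

text \<open>\<open>T\<close> consists of complete blocks of \<open>S\<close> iff the union
  \<open>B' T\<close> lies in \<open>S\<close>, so the dividends of \<open>g\<close> carry over from
  \<open>T\<close> to \<open>B' T\<close>. Equal block sizes make the factor \<open>1 / m\<close>
  the same for every \<open>T\<close>, so it leaves the sum.\<close>

lemma shapley_uniform_copies:
  fixes B :: "'p \<Rightarrow> 'q set"
  assumes "finite N" and disj: "disjoint_family_on B N"
    and B: "\<And>e. e \<in> N \<Longrightarrow> finite (B e)" "\<And>e. e \<in> N \<Longrightarrow> card (B e) = m"
    and e: "e \<in> N" and l: "l \<in> B e"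
  shows "shapley (\<Union>e\<in>N. B e) (\<lambda>S. g {e \<in> N. B e \<subseteq> S}) l = shapley N g e / real m"
proof -
  define U where "U = (\<Union>e\<in>N. B e)"
  define B' where "B' T = (\<Union>e\<in>T. B e)" for T
  obtain c where c: "\<And>S. S \<subseteq> N \<Longrightarrow> g S = (\<Sum>T\<in>Pow N. c T * unanimity_game T S)"
    using ex_dividends[OF \<open>finite N\<close>, of g] by blast
  have "finite U"
    using assms by (auto simp: U_def)
  have "g {e \<in> N. B e \<subseteq> S} = (\<Sum>T\<in>Pow N. c T * unanimity_game (B' T) S)" for S
  proof -
    have "unanimity_game T {e \<in> N. B e \<subseteq> S} = unanimity_game (B' T) S" if "T \<subseteq> N" for T
      using that by (auto simp: unanimity_game_def B'_def UN_subset_iff)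
    then show ?thesis
      by (simp add: c)
  qed
  then have "shapley U (\<lambda>S. g {e \<in> N. B e \<subseteq> S}) l =
      (\<Sum>T\<in>Pow N. c T * shapley U (unanimity_game (B' T)) l)"
    by (simp add: shapley_sum)
  also have "\<dots> = (\<Sum>T\<in>Pow N. c T * (shapley N (unanimity_game T) e / real m))"
  proof (rule sum.cong)
    fix T assume "T \<in> Pow N"
    then have T: "T \<subseteq> N"
      by simp
    then have "B' T \<subseteq> U"
      by (auto simp: B'_def U_def)
    \<comment> \<open>By disjointness, \<open>B e\<close> is the only block containing
      \<open>l\<close>.\<close>
    have "l \<in> B' T \<longleftrightarrow> e \<in> T"
      using disjoint_family_onD[OF disj _ e] T l by (force simp: B'_def)
    moreover have "card (B' T) = card T * m"
    proof -
      have "card (B' T) = (\<Sum>e\<in>T. card (B e))"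
        unfolding B'_def using T disj B(1) finite_subset[OF T \<open>finite N\<close>]
        by (intro card_UN_disjoint) (auto simp: disjoint_family_on_def subset_iff)
      also have "\<dots> = (\<Sum>e\<in>T. m)"
        using T B(2) by (intro sum.cong) auto
      finally show ?thesis
        by simp
    qed
    ultimately show "c T * shapley U (unanimity_game (B' T)) l =
        c T * (shapley N (unanimity_game T) e / real m)"
      using shapley_unanimity_game[OF \<open>finite U\<close> \<open>B' T \<subseteq> U\<close>, of l]
        shapley_unanimity_game[OF \<open>finite N\<close> T, of e] by simp
  qed simp
  also have "\<dots> = shapley N (\<lambda>S. \<Sum>T\<in>Pow N. c T * unanimity_game T S) e / real m"
    by (simp add: shapley_sum sum_divide_distrib)
  also have "\<dots> = shapley N g e / real m"
    using c by (subst shapley_cong[OF e, of g]) auto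
  finally show ?thesis
    by (simp add: U_def)
qed

section \<open>Counting the copies\<close>

lemma U_node_link_eq_image:
  "U_node_link H k i e = (\<lambda>t. (i, e, t)) ` {1..\<rho> H k div card e}"
  by (auto simp: U_node_link_def)

lemma finite_U_node_link: "finite (U_node_link H k i e)"
  by (simp add: U_node_link_eq_image)

lemma card_U_node_link: "card (U_node_link H k i e) = \<rho> H k div card e"
  by (simp add: U_node_link_eq_image card_image inj_on_def)

text \<open>Each of the \<open>card e\<close> nodes contributes \<open>\<rho> H k div card e\<close>
  copies, and the division is exact. Hence links of different sizes get equally many copies, which
  is the purpose of the least common multiple.\<close>

lemma card_U_link:
  assumes "e \<in> H" "finite e"
  shows "card (U_link H k e) = \<rho> H k"
proof -
  have "card (U_link H k e) = (\<Sum>i\<in>e. card (U_node_link H k i e))"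
    unfolding U_link_def using assms
    by (intro card_UN_disjoint) (auto simp: finite_U_node_link, auto simp: U_node_link_def)
  then show ?thesis
    using assms(1) by (simp add: card_U_node_link card_dvd_\<rho>)
qed

lemma \<rho>_pos:
  assumes "finite H" "\<And>e. e \<in> H \<Longrightarrow> card e > 0" "k > 0"
  shows "\<rho> H k > 0"
proof -
  have "0 \<notin> card ` H"
    using assms(2) by fastforce
  \<comment> \<open>Finiteness matters: the \<open>Lcm\<close> of an infinite set of naturals is 0,
    that of a finite set is 0 only if 0 is a member.\<close>
  then have "Lcm (card ` H) \<noteq> 0"
    using assms(1) by (simp add: Lcm_0_iff)
  then show ?thesis
    using assms(3) by (simp add: \<rho>_def \<eta>_def)
qed

theorem theorem3p2:
  fixes N :: "nat set" and v :: "nat set \<Rightarrow> real" and H :: "nat set set"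
    and k :: nat and i :: nat
  assumes "hypergraph_situation N v H"
    and "k \<ge> 1"
    and "i \<in> N"
  shows "position_value N v H i =
    (\<Sum>l\<in>U_node H k i. shapley (U_all N H k) (augmented_game N v H k) l)"
proof -
  have "finite N" and H: "H \<subseteq> {e. e \<subseteq> N \<and> card e > 1}"
    using assms(1) by (auto simp: hypergraph_situation_def tu_game_def)
  have "finite H"
    using \<open>finite N\<close> H by (auto intro: finite_subset[of H "Pow N"])
  have e: "finite e" "card e > 0" if "e \<in> H" for e
    using H \<open>finite N\<close> that by (auto intro: finite_subset[of e N])
  have \<rho>: "\<rho> H k > 0"
    using \<open>finite H\<close> e(2) assms(2) by (intro \<rho>_pos) auto
  \<comment> \<open>The form required by \<open>shapley_uniform_copies\<close>, with blocks
    \<open>U_link H k e\<close> and \<open>g\<close> the hyperlink game.\<close>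
  have game: "augmented_game N v H k =
      (\<lambda>S. hyperlink_game N v {e \<in> H. U_link H k e \<subseteq> S})"
    by (simp add: fun_eq_iff augmented_game_def hyperlink_game_def complete_links_def)
  have copy: "shapley (U_all N H k) (augmented_game N v H k) l =
      shapley H (hyperlink_game N v) e / real (\<rho> H k)" if "e \<in> H" "l \<in> U_link H k e" for e l
    unfolding U_all_eq_UN_U_link[OF assms(1)] game
  proof (rule shapley_uniform_copies)
    \<comment> \<open>Each copy records its link as second component.\<close>
    show "disjoint_family_on (U_link H k) H"
      by (auto simp: disjoint_family_on_def U_link_def U_node_link_def)
  qed (use \<open>finite H\<close> that e in \<open>auto simp: card_U_link, auto simp: U_link_def finite_U_node_link\<close>)
  have "(\<Sum>l\<in>U_node H k i. shapley (U_all N H k) (augmented_game N v H k) l) =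
      (\<Sum>e\<in>links_at H i. \<Sum>l\<in>U_node_link H k i e.
        shapley (U_all N H k) (augmented_game N v H k) l)"
    unfolding U_node_def using \<open>finite H\<close>
    by (intro sum.UNION_disjoint)
      (auto simp: links_at_def finite_U_node_link, auto simp: U_node_link_def)
  also have "\<dots> = (\<Sum>e\<in>links_at H i. 1 / real (card e) * shapley H (hyperlink_game N v) e)"
  proof (rule sum.cong)
    fix e assume "e \<in> links_at H i"
    then have "e \<in> H" "i \<in> e"
      by (auto simp: links_at_def)
    then have "(\<Sum>l\<in>U_node_link H k i e. shapley (U_all N H k) (augmented_game N v H k) l) =
        (\<Sum>l\<in>U_node_link H k i e. shapley H (hyperlink_game N v) e / real (\<rho> H k))"
      by (intro sum.cong copy) (auto simp: U_link_def)
    also have "\<dots> = real (\<rho> H k div card e) * shapley H (hyperlink_game N v) e / real (\<rho> H k)"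
      by (simp add: card_U_node_link)
    \<comment> \<open>Exact division turns the share of node \<open>i\<close> among the copies of
      \<open>e\<close> into \<open>1 / card e\<close>.\<close>
    also have "\<dots> = 1 / real (card e) * shapley H (hyperlink_game N v) e"
      using card_dvd_\<rho>[OF \<open>e \<in> H\<close>, of k] \<rho> by (simp add: real_of_nat_div)
    finally show "(\<Sum>l\<in>U_node_link H k i e.
        shapley (U_all N H k) (augmented_game N v H k) l) =
        1 / real (card e) * shapley H (hyperlink_game N v) e" .
  qed simp
  finally show ?thesis
    by (simp add: position_value_def)
qed

end
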